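(* Let $n\ge 1$, let $\alpha>0$ and $\beta,\gamma,\delta\ge 0$ be real numbers, let $S\in\mathbb{R}^{n\times n}$, and let $$A=\begin{bmatrix}0 & I\\ -\alpha S-\delta I & -\beta S-\gamma I\end{bmatrix}\in\mathbb{R}^{2n\times 2n}.$$ Assume that there exist an orthogonal matrix $Q\in\mathbb{R}^{n\times n}$ and a diagonal matrix $D=\operatorname{diag}\{\lambda_1,\dots,\lambda_n\}\in\mathbb{R}^{n\times n}$ such that $S=QDQ'$. Then, for every $t>0$ and every integer $k\ge 1$, $$\varphi_k(tA)=\begin{bmatrix}Q&0\\0&Q\end{bmatrix}P\begin{bmatrix}\varphi_k(tG_1)&0&\cdots&0\\0&\varphi_k(tG_2)&\cdots&0\\ \vdots&\vdots&\ddots&0\\0&0&\cdots&\varphi_k(tG_n)\end{bmatrix}P'\begin{bmatrix}Q'&0\\0&Q'\end{bmatrix},$$ where $$G_i=\begin{bmatrix}0&1\\-\alpha\lambda_i-\delta&-\beta\lambda_i-\gamma\end{bmatrix},\qquad 1\le i\le n,$$ and $P\in\mathbb{R}^{2n\times 2n}$ is the permutation matrix with $P_{i,2i-1}=1$ and $P_{i+n,2i}=1$ for $1\le i\le n$, and all other entries equal to $0$.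
   Context: $E'$ denotes the transpose of a matrix $E$; $I$ denotes the identity matrix of the appropriate size. For $k\ge1$, $\varphi_k$ is the entire function $$\varphi_k(z)=\int_0^1\mathrm{e}^{(1-\theta)z}\frac{\theta^{k-1}}{(k-1)!}\,d\theta=\sum_{j=0}^\infty\frac{z^j}{(j+k)!},$$ and for a square matrix $M$, $\varphi_k(M)=\sum_{j=0}^\infty\frac{M^j}{(j+k)!}$. *)

theory Defs
  imports Complex_Main "Jordan_Normal_Form.Matrix"
begin

(* The library predicate orthogonal_mat only asks for nonzero, pairwise orthogonal columns, so it is
   not the usual notion of an orthogonal matrix. *)
definition orthogonal_matrix_of_dim :: "nat \<Rightarrow> real mat \<Rightarrow> bool" where
  "orthogonal_matrix_of_dim n Q \<longleftrightarrow>
     Q \<in> carrier_mat n n \<and> Q * Q\<^sup>T = 1\<^sub>m n \<and> Q\<^sup>T * Q = 1\<^sub>m n"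

(* Matrices with run-time dimensions carry no topology, so the matrix series is summed entry by
   entry; by phi_mat_sums below every entry converges for every square matrix. *)
definition phi_mat :: "nat \<Rightarrow> real mat \<Rightarrow> real mat" where
  "phi_mat k M = mat (dim_row M) (dim_row M)
     (\<lambda>(r, c). \<Sum>j. (M ^\<^sub>m j) $$ (r, c) / fact (j + k))"

definition damped_block_mat :: "nat \<Rightarrow> real \<Rightarrow> real \<Rightarrow> real \<Rightarrow> real \<Rightarrow> real mat \<Rightarrow> real mat" where
  "damped_block_mat n \<alpha> \<beta> \<gamma> \<delta> S = four_block_mat
     (0\<^sub>m n n) (1\<^sub>m n)
     ((- \<alpha>) \<cdot>\<^sub>m S - \<delta> \<cdot>\<^sub>m 1\<^sub>m n) ((- \<beta>) \<cdot>\<^sub>m S - \<gamma> \<cdot>\<^sub>m 1\<^sub>m n)"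

definition damped_scalar_mat :: "real \<Rightarrow> real \<Rightarrow> real \<Rightarrow> real \<Rightarrow> real \<Rightarrow> real mat" where
  "damped_scalar_mat \<alpha> \<beta> \<gamma> \<delta> l = mat_of_rows_list 2
     [[0, 1],
      [- \<alpha> * l - \<delta>, - \<beta> * l - \<gamma>]]"

(* Matrix indices start at 0: the 1-based positions (i, 2i-1) and (i+n, 2i) with 1 \<le> i \<le> n become
   (i, 2i) and (i+n, 2i+1) with i < n. *)
definition shuffle_perm_mat :: "nat \<Rightarrow> real mat" where
  "shuffle_perm_mat n = mat (2 * n) (2 * n)
     (\<lambda>(r, c). if \<exists>i<n. (r, c) = (i, 2 * i) \<or> (r, c) = (i + n, 2 * i + 1) then 1 else 0)"

lemma pow_mat_entry_bound:
  fixes M :: "real mat"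
  assumes M: "M \<in> carrier_mat n n"
    and b: "\<And>r c. r < n \<Longrightarrow> c < n \<Longrightarrow> \<bar>M $$ (r, c)\<bar> \<le> b"
    and "r < n" "c < n"
  shows "\<bar>(M ^\<^sub>m j) $$ (r, c)\<bar> \<le> (real n * b) ^ j"
  using \<open>c < n\<close>
proof (induction j arbitrary: c)
  case 0
  then show ?case using M \<open>r < n\<close> by auto
next
  case (Suc j)
  have P: "M ^\<^sub>m j \<in> carrier_mat n n" using M by simp
  have nb: "0 \<le> real n * b" using b[OF \<open>r < n\<close> \<open>r < n\<close>] by simp
  have "(M ^\<^sub>m Suc j) $$ (r, c) = (\<Sum>i<n. (M ^\<^sub>m j) $$ (r, i) * M $$ (i, c))"
    using P M \<open>r < n\<close> \<open>c < n\<close>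
    by (simp add: scalar_prod_def atLeast0LessThan)
  also have "\<bar>\<dots>\<bar> \<le> (\<Sum>i<n. \<bar>(M ^\<^sub>m j) $$ (r, i) * M $$ (i, c)\<bar>)"
    by (rule sum_abs)
  also have "\<dots> \<le> (\<Sum>i<n. (real n * b) ^ j * b)"
    using Suc b nb by (intro sum_mono) (auto simp: abs_mult intro!: mult_mono)
  also have "\<dots> = (real n * b) ^ Suc j" by simp
  finally show ?case .
qed

lemma phi_mat_sums:
  assumes M: "M \<in> carrier_mat n n" and "r < n" "c < n"
  shows "(\<lambda>j. (M ^\<^sub>m j) $$ (r, c) / fact (j + k)) sums (phi_mat k M $$ (r, c))"
proof -
  define b where "b = Max ((\<lambda>(r, c). \<bar>M $$ (r, c)\<bar>) ` ({..<n} \<times> {..<n}))"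
  have b: "\<bar>M $$ (r, c)\<bar> \<le> b" if "r < n" "c < n" for r c
    unfolding b_def using that by (intro Max_ge) (auto intro!: image_eqI[of _ _ "(r, c)"])
  have "norm ((M ^\<^sub>m j) $$ (r, c) / fact (j + k)) \<le> inverse (fact j) * (real n * b) ^ j" for j
  proof -
    have "\<bar>(M ^\<^sub>m j) $$ (r, c)\<bar> / fact (j + k) \<le> (real n * b) ^ j / fact j"
      using pow_mat_entry_bound[OF M b assms(2,3)]
      by (intro frac_le) (auto intro: fact_mono order_trans[OF abs_ge_zero])
    then show ?thesis by (simp add: field_simps)
  qed
  then have "summable (\<lambda>j. (M ^\<^sub>m j) $$ (r, c) / fact (j + k))"
    by (intro summable_comparison_test'[OF summable_exp]) auto
  then show ?thesis
    using assms by (auto simp: phi_mat_def summable_sums)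
qed

end

theory Submission
  imports Defs "Jordan_Normal_Form.Determinant"
begin

text \<open>Conjugation by an invertible matrix and direct sums both commute with powers, hence with
  \<open>\<phi>\<^sub>k\<close>. Conjugating \<open>A\<close> by \<open>diag(Q, Q)\<close> turns its four blocks into diagonal matrices, and the
  perfect shuffle \<open>P\<close> regroups coordinates \<open>i\<close> and \<open>i + n\<close> into the blocks \<open>G\<^sub>i\<close>.\<close>

section \<open>Behaviour of phi_k under similarity and direct sums\<close>

lemma phi_mat_carrier [simp]: "M \<in> carrier_mat n n \<Longrightarrow> phi_mat k M \<in> carrier_mat n n"
  by (auto simp: phi_mat_def)

text \<open>Uniqueness of limits reduces every identity for \<open>phi_mat\<close> below to summing
  one real series per entry.\<close>

lemma phi_mat_eqI:
  assumes "M \<in> carrier_mat n n" "X \<in> carrier_mat n n"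
    and "\<And>r c. r < n \<Longrightarrow> c < n \<Longrightarrow> (\<lambda>j. (M ^\<^sub>m j) $$ (r, c) / fact (j + k)) sums (X $$ (r, c))"
  shows "phi_mat k M = X"
proof (rule eq_matI)
  fix r c assume "r < dim_row X" "c < dim_col X"
  then show "phi_mat k M $$ (r, c) = X $$ (r, c)"
    using assms(2) by (intro sums_unique2[OF phi_mat_sums[OF assms(1)] assms(3)]) auto
qed (use assms in \<open>auto simp: phi_mat_def\<close>)

text \<open>As a finite double sum the triple product is visibly linear in the entries of
  \<open>X\<close>, so a convergent series can be passed through it.\<close>

lemma index_mult_mult_mat:
  assumes "U \<in> carrier_mat n n" "X \<in> carrier_mat n n" "V \<in> carrier_mat n n" "r < n" "c < n"
  shows "(U * X * V) $$ (r, c) = (\<Sum>b<n. \<Sum>a<n. U $$ (r, a) * X $$ (a, b) * V $$ (b, c))"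
  \<comment> \<open>The bracketing \<open>(U * X) * V\<close> is kept, so that the sum over
    \<open>b\<close> stays outermost.\<close>
  using assms by (simp add: scalar_prod_def atLeast0LessThan sum_distrib_right del: assoc_mult_mat)

text \<open>Since \<open>A ^\<^sub>m j\<close> equals \<open>U * B ^\<^sub>m j * V\<close>, each
  entry of a power of \<open>A\<close> is a combination of the entries of the same power of
  \<open>B\<close>, with coefficients independent of \<open>j\<close>. The entry series of
  \<open>B\<close> therefore combine term by term.\<close>

lemma phi_mat_similar:
  assumes "similar_mat_wit A B U V"
  shows "phi_mat k A = U * phi_mat k B * V"
proof -
  define n where "n = dim_row A"
  note D = similar_mat_witD[OF n_def assms]
  show ?thesis
  proof (rule phi_mat_eqI)
    fix r c assume rc: "r < n" "c < n"
    have "(\<lambda>j. \<Sum>b<n. \<Sum>a<n. U $$ (r, a) * ((B ^\<^sub>m j) $$ (a, b) / fact (j + k)) * V $$ (b, c)) sums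
        (\<Sum>b<n. \<Sum>a<n. U $$ (r, a) * phi_mat k B $$ (a, b) * V $$ (b, c))"
      using phi_mat_sums[OF D(5)] by (intro sums_sum sums_mult sums_mult2) auto
    also have "(\<lambda>j. \<Sum>b<n. \<Sum>a<n. U $$ (r, a) * ((B ^\<^sub>m j) $$ (a, b) / fact (j + k)) * V $$ (b, c)) =
        (\<lambda>j. (A ^\<^sub>m j) $$ (r, c) / fact (j + k))"
      using D rc unfolding similar_mat_wit_pow_id[OF assms]
      by (subst index_mult_mult_mat[of _ n]) (auto simp: sum_divide_distrib)
    also have "(\<Sum>b<n. \<Sum>a<n. U $$ (r, a) * phi_mat k B $$ (a, b) * V $$ (b, c)) =
        (U * phi_mat k B * V) $$ (r, c)"
      using D rc by (subst index_mult_mult_mat[of _ n]) auto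
    finally show "(\<lambda>j. (A ^\<^sub>m j) $$ (r, c) / fact (j + k)) sums (U * phi_mat k B * V) $$ (r, c)" .
  qed (use D in \<open>auto intro!: mult_carrier_mat\<close>)
qed

text \<open>Every power, the zeroth included, is again block diagonal, so the series in the
  off-diagonal blocks vanish term by term.\<close>

lemma phi_mat_four_block_diag:
  assumes A: "A \<in> carrier_mat n n" and B: "B \<in> carrier_mat m m"
  shows "phi_mat k (four_block_mat A (0\<^sub>m n m) (0\<^sub>m m n) B) =
    four_block_mat (phi_mat k A) (0\<^sub>m n m) (0\<^sub>m m n) (phi_mat k B)"
proof (rule phi_mat_eqI)
  fix r c assume rc: "r < n + m" "c < n + m"
  \<comment> \<open>The blocks are left arbitrary because the formula is applied both to the powers
    and to the values of \<open>phi_mat\<close>.\<close>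
  have entry: "four_block_mat X (0\<^sub>m n m) (0\<^sub>m m n) Y $$ (r, c) =
      (if r < n then if c < n then X $$ (r, c) else 0
       else if c < n then 0 else Y $$ (r - n, c - n))"
    if "X \<in> carrier_mat n n" "Y \<in> carrier_mat m m" for X Y :: "real mat"
    using rc that by auto
  show "(\<lambda>j. (four_block_mat A (0\<^sub>m n m) (0\<^sub>m m n) B ^\<^sub>m j) $$ (r, c) / fact (j + k)) sums
      four_block_mat (phi_mat k A) (0\<^sub>m n m) (0\<^sub>m m n) (phi_mat k B) $$ (r, c)"
    unfolding pow_four_block_mat[OF A B] entry[OF pow_carrier_mat[OF A] pow_carrier_mat[OF B]]
      entry[OF phi_mat_carrier[OF A] phi_mat_carrier[OF B]]
    using rc phi_mat_sums[OF A] phi_mat_sums[OF B] by auto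
qed (use A B in auto)

lemma phi_mat_diag_block:
  assumes "\<forall>A\<in>set As. square_mat A"
  shows "phi_mat k (diag_block_mat As) = diag_block_mat (map (phi_mat k) As)"
  using assms
proof (induction As)
  case Nil
  \<comment> \<open>The empty direct sum is the 0 x 0 matrix.\<close>
  then show ?case by (auto simp: phi_mat_def)
next
  case (Cons A As)
  define n m where "n = dim_row A" and "m = dim_row (diag_block_mat As)"
  have A: "A \<in> carrier_mat n n" using Cons.prems by (auto simp: n_def)
  have B: "diag_block_mat As \<in> carrier_mat m m"
    using diag_block_mat_square[of As] Cons.prems by (auto simp: m_def)
  have IH: "diag_block_mat (map (phi_mat k) As) = phi_mat k (diag_block_mat As)"
    using Cons by simp
  have "phi_mat k (diag_block_mat (A # As)) =
      phi_mat k (four_block_mat A (0\<^sub>m n m) (0\<^sub>m m n) (diag_block_mat As))"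
    by (simp add: Let_def carrier_matD[OF A] carrier_matD[OF B])
  also have "\<dots> = four_block_mat (phi_mat k A) (0\<^sub>m n m) (0\<^sub>m m n) (phi_mat k (diag_block_mat As))"
    by (rule phi_mat_four_block_diag[OF A B])
  also have "\<dots> = diag_block_mat (map (phi_mat k) (A # As))"
    by (simp add: Let_def IH carrier_matD[OF phi_mat_carrier[OF A]]
        carrier_matD[OF phi_mat_carrier[OF B]])
  finally show ?case .
qed

section \<open>Scaling and entries of block diagonal matrices\<close>

lemma smult_diag_block_mat:
  fixes a :: "'a :: mult_zero"
  shows "a \<cdot>\<^sub>m diag_block_mat As = diag_block_mat (map ((\<cdot>\<^sub>m) a) As)"
proof (induction As)
  case (Cons A As)
  show ?case by (rule eq_matI) (auto simp: Let_def simp flip: Cons.IH)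
qed auto

text \<open>With equal block sizes, \<open>div\<close> names the block and \<open>mod\<close> the
  position inside it. The induction splits off the last block, so the offsets of the earlier ones do
  not move.\<close>

lemma index_diag_block_mat_map:
  assumes B: "\<And>i. B i \<in> carrier_mat m m" and "r < n * m" "c < n * m"
  shows "diag_block_mat (map B [0..<n]) $$ (r, c) =
    (if r div m = c div m then B (r div m) $$ (r mod m, c mod m) else 0)"
  using assms(2,3)
proof (induction n)
  case (Suc n)
  have dim: "dim_row (diag_block_mat (map B [0..<n])) = n * m"
    "dim_col (diag_block_mat (map B [0..<n])) = n * m" "dim_row (B n) = m" "dim_col (B n) = m"
    using B by (auto simp: dim_diag_block_mat o_def sum_list_triv carrier_matD[OF B])
  have hi: "i div m = n" "i mod m = i - n * m" if "\<not> i < n * m" "i < Suc n * m" for i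
  proof -
    show "i div m = n" using that by (intro div_nat_eqI) (auto simp: mult.commute)
    then show "i mod m = i - n * m" by (simp add: modulo_nat_def mult.commute)
  qed
  have lo: "i div m < n" if "i < n * m" for i
    using that by (simp add: less_mult_imp_div_less)
  have entry: "diag_block_mat (map B [0..<Suc n]) $$ (r, c) =
      (if r < n * m then if c < n * m then diag_block_mat (map B [0..<n]) $$ (r, c) else 0
       else if c < n * m then 0 else B n $$ (r - n * m, c - n * m))"
    using Suc.prems by (simp add: diag_block_mat_append Let_def dim less_diff_conv2)
  show ?case
  proof (cases "r < n * m"; cases "c < n * m")
    assume "r < n * m" "c < n * m"
    then show ?thesis unfolding entry by (simp add: Suc.IH)
  next
    assume "r < n * m" "\<not> c < n * m"
    then show ?thesis unfolding entry using lo[of r] hi(1)[of c] Suc.prems by simp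
  next
    assume "\<not> r < n * m" "c < n * m"
    then show ?thesis unfolding entry using hi(1)[of r] lo[of c] Suc.prems by simp
  next
    assume rc: "\<not> r < n * m" "\<not> c < n * m"
    then show ?thesis
      unfolding entry hi[OF rc(1) Suc.prems(1)] hi[OF rc(2) Suc.prems(2)] by simp
  qed
qed simp

section \<open>The perfect shuffle as a map on indices\<close>

definition shuffle_index :: "nat \<Rightarrow> nat \<Rightarrow> nat" where
  "shuffle_index n r = (if r < n then 2 * r else 2 * (r - n) + 1)"

lemma shuffle_index_less: "r < 2 * n \<Longrightarrow> shuffle_index n r < 2 * n"
  by (auto simp: shuffle_index_def)

text \<open>Parity tells which half the index came from, and halving then recovers it.\<close>

lemma shuffle_index_eq_iff: "shuffle_index n r = shuffle_index n c \<longleftrightarrow> r = c"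
  by (auto simp: shuffle_index_def split: if_splits) presburger+

lemma shuffle_perm_mat_carrier [simp]: "shuffle_perm_mat n \<in> carrier_mat (2 * n) (2 * n)"
  by (simp add: shuffle_perm_mat_def)

lemma index_shuffle_perm_mat:
  assumes "r < 2 * n" "c < 2 * n"
  shows "shuffle_perm_mat n $$ (r, c) = (if c = shuffle_index n r then 1 else 0)"
proof -
  have "(\<exists>i<n. r = i \<and> c = 2 * i \<or> r = i + n \<and> c = Suc (2 * i)) \<longleftrightarrow> c = shuffle_index n r"
    unfolding shuffle_index_def using assms by (auto intro: exI[of _ "r - n"])
  then show ?thesis using assms by (simp add: shuffle_perm_mat_def)
qed

text \<open>Row \<open>r\<close> of the permutation matrix is the unit vector at
  \<open>shuffle_index n r\<close>, so conjugation merely relabels rows and columns and each sum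
  keeps a single term.\<close>

lemma shuffle_conjugate_index:
  assumes X: "X \<in> carrier_mat (2 * n) (2 * n)" and rc: "r < 2 * n" "c < 2 * n"
  shows "(shuffle_perm_mat n * X * (shuffle_perm_mat n)\<^sup>T) $$ (r, c) =
    X $$ (shuffle_index n r, shuffle_index n c)"
proof -
  have "(shuffle_perm_mat n * X * (shuffle_perm_mat n)\<^sup>T) $$ (r, c) =
      (\<Sum>b<2*n. \<Sum>a<2*n. (if a = shuffle_index n r then 1 else 0) * X $$ (a, b) *
        (if b = shuffle_index n c then 1 else 0))"
    using X rc carrier_matD[OF shuffle_perm_mat_carrier[of n]]
    by (subst index_mult_mult_mat[of _ "2 * n"]) (auto simp: index_shuffle_perm_mat)
  \<comment> \<open>The 0-1 factors become nested conditionals, the form in which both sums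
    collapse.\<close>
  also have "\<dots> = (\<Sum>b<2*n. if b = shuffle_index n c
      then \<Sum>a<2*n. if a = shuffle_index n r then X $$ (a, b) else 0 else 0)"
    by (intro sum.cong refl) (simp add: if_distrib[of "\<lambda>x. x * _"] cong: if_cong)
  also have "\<dots> = X $$ (shuffle_index n r, shuffle_index n c)"
    using rc by (simp add: shuffle_index_less)
  finally show ?thesis .
qed

lemma shuffle_perm_mat_inverse:
  "shuffle_perm_mat n * (shuffle_perm_mat n)\<^sup>T = 1\<^sub>m (2 * n)"
  "(shuffle_perm_mat n)\<^sup>T * shuffle_perm_mat n = 1\<^sub>m (2 * n)"
proof -
  \<comment> \<open>Inserting the identity makes this a case of the relabelling formula; injectivity
    of \<open>shuffle_index\<close> then gives the identity back.\<close>
  have "shuffle_perm_mat n * 1\<^sub>m (2 * n) * (shuffle_perm_mat n)\<^sup>T = 1\<^sub>m (2 * n)"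
  proof (rule eq_matI)
    fix r c assume "r < dim_row (1\<^sub>m (2 * n))" "c < dim_col (1\<^sub>m (2 * n))"
    then show "(shuffle_perm_mat n * 1\<^sub>m (2 * n) * (shuffle_perm_mat n)\<^sup>T) $$ (r, c) =
        1\<^sub>m (2 * n) $$ (r, c)"
      by (subst shuffle_conjugate_index)
        (auto simp: shuffle_index_less shuffle_index_eq_iff)
  qed (auto simp: carrier_matD[OF shuffle_perm_mat_carrier[of n]])
  then show inv: "shuffle_perm_mat n * (shuffle_perm_mat n)\<^sup>T = 1\<^sub>m (2 * n)"
    by (simp add: right_mult_one_mat[OF shuffle_perm_mat_carrier])
  show "(shuffle_perm_mat n)\<^sup>T * shuffle_perm_mat n = 1\<^sub>m (2 * n)"
    \<comment> \<open>A one-sided inverse of a square matrix is two-sided.\<close>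
    by (rule mat_mult_left_right_inverse[OF _ _ inv]) auto
qed

section \<open>Reduction of the damped block matrix to 2 x 2 blocks\<close>

lemma damped_scalar_mat_carrier [simp]: "damped_scalar_mat \<alpha> \<beta> \<gamma> \<delta> l \<in> carrier_mat 2 2"
  by (simp add: damped_scalar_mat_def mat_of_rows_list_def numeral_2_eq_2)

lemma index_damped_scalar_mat:
  "damped_scalar_mat \<alpha> \<beta> \<gamma> \<delta> l $$ (0, 0) = 0"
  "damped_scalar_mat \<alpha> \<beta> \<gamma> \<delta> l $$ (0, Suc 0) = 1"
  "damped_scalar_mat \<alpha> \<beta> \<gamma> \<delta> l $$ (Suc 0, 0) = - \<alpha> * l - \<delta>"
  "damped_scalar_mat \<alpha> \<beta> \<gamma> \<delta> l $$ (Suc 0, Suc 0) = - \<beta> * l - \<gamma>"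
  by (simp_all add: damped_scalar_mat_def mat_of_rows_list_def)

lemma damped_block_mat_carrier:
  "S \<in> carrier_mat n n \<Longrightarrow> damped_block_mat n \<alpha> \<beta> \<gamma> \<delta> S \<in> carrier_mat (2 * n) (2 * n)"
  by (auto simp: damped_block_mat_def)

text \<open>All four blocks are diagonal, so a nonzero entry \<open>(r, c)\<close> has
  \<open>r\<close> and \<open>c\<close> congruent modulo \<open>n\<close>. That common residue is
  the shuffled index \<open>div 2\<close>, the number of the 2 x 2 block; the shuffled index
  \<open>mod 2\<close> records the half and hence the position in that block.\<close>

lemma damped_block_mat_diag_similar:
  "similar_mat_wit (damped_block_mat n \<alpha> \<beta> \<gamma> \<delta> (mat_diag n lam))
    (diag_block_mat (map (\<lambda>i. damped_scalar_mat \<alpha> \<beta> \<gamma> \<delta> (lam i)) [0..<n]))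
    (shuffle_perm_mat n) (shuffle_perm_mat n)\<^sup>T"
  (is "similar_mat_wit ?A ?G ?P _")
proof (rule similar_mat_witI)
  show A: "?A \<in> carrier_mat (2 * n) (2 * n)" by (simp add: damped_block_mat_carrier)
  show G: "?G \<in> carrier_mat (2 * n) (2 * n)"
    by (intro carrier_matI) (simp_all add: dim_diag_block_mat o_def sum_list_triv
        carrier_matD[OF damped_scalar_mat_carrier])
  show "?A = ?P * ?G * ?P\<^sup>T"
  proof (rule eq_matI)
    fix r c assume "r < dim_row (?P * ?G * ?P\<^sup>T)" "c < dim_col (?P * ?G * ?P\<^sup>T)"
    then have rc: "r < 2 * n" "c < 2 * n"
      using carrier_matD[OF shuffle_perm_mat_carrier[of n]] by auto
    have "(?P * ?G * ?P\<^sup>T) $$ (r, c) = ?G $$ (shuffle_index n r, shuffle_index n c)"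
      by (rule shuffle_conjugate_index[OF G rc])
    also have "\<dots> = ?A $$ (r, c)"
      using rc shuffle_index_less[OF rc(1)] shuffle_index_less[OF rc(2)]
      by (subst index_diag_block_mat_map[where m = 2])
        (auto simp: shuffle_index_def damped_block_mat_def mat_diag_def index_damped_scalar_mat)
    finally show "?A $$ (r, c) = (?P * ?G * ?P\<^sup>T) $$ (r, c)" by simp
  qed (use A carrier_matD[OF shuffle_perm_mat_carrier[of n]] in auto)
qed (auto simp: shuffle_perm_mat_inverse)

text \<open>Each block is zero or of the form \<open>a S + b I\<close>, so the same \<open>Q\<close>
  conjugates all four at once.\<close>

lemma damped_block_mat_similar:
  assumes Q: "orthogonal_matrix_of_dim n Q" and D: "D \<in> carrier_mat n n"
  shows "similar_mat_wit (damped_block_mat n \<alpha> \<beta> \<gamma> \<delta> (Q * D * Q\<^sup>T)) (damped_block_mat n \<alpha> \<beta> \<gamma> \<delta> D)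
    (four_block_mat Q (0\<^sub>m n n) (0\<^sub>m n n) Q) (four_block_mat Q\<^sup>T (0\<^sub>m n n) (0\<^sub>m n n) Q\<^sup>T)"
proof -
  have QC: "Q \<in> carrier_mat n n" and QT: "Q\<^sup>T \<in> carrier_mat n n"
    and inv: "Q * Q\<^sup>T = 1\<^sub>m n" "Q\<^sup>T * Q = 1\<^sub>m n"
    using Q by (auto simp: orthogonal_matrix_of_dim_def)
  \<comment> \<open>The shift by a multiple of the identity survives because
    \<open>Q * Q\<^sup>T\<close> is the identity.\<close>
  have conj: "a \<cdot>\<^sub>m (Q * D * Q\<^sup>T) - b \<cdot>\<^sub>m 1\<^sub>m n = Q * (a \<cdot>\<^sub>m D - b \<cdot>\<^sub>m 1\<^sub>m n) * Q\<^sup>T" for a b :: real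
  proof -
    have "Q * (a \<cdot>\<^sub>m D - b \<cdot>\<^sub>m 1\<^sub>m n) * Q\<^sup>T = (a \<cdot>\<^sub>m (Q * D) - b \<cdot>\<^sub>m Q) * Q\<^sup>T"
      using QC D by (subst mult_minus_distrib_mat[of _ n n])
        (auto simp: mult_smult_distrib[of _ n n _ n])
    also have "\<dots> = a \<cdot>\<^sub>m (Q * D * Q\<^sup>T) - b \<cdot>\<^sub>m (Q * Q\<^sup>T)"
      using QC QT D by (subst minus_mult_distrib_mat[of _ n n])
        (auto simp: mult_smult_assoc_mat[of _ n n _ n])
    finally show ?thesis by (simp add: inv)
  qed
  have wit0: "similar_mat_wit (0\<^sub>m n n) (0\<^sub>m n n) Q Q\<^sup>T"
    using QC QT inv by (auto intro!: similar_mat_witI[of _ _ n])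
  have wit: "similar_mat_wit ((- \<beta>) \<cdot>\<^sub>m (Q * D * Q\<^sup>T) - \<gamma> \<cdot>\<^sub>m 1\<^sub>m n) ((- \<beta>) \<cdot>\<^sub>m D - \<gamma> \<cdot>\<^sub>m 1\<^sub>m n) Q Q\<^sup>T"
    by (rule similar_mat_witI[OF inv conj]) (use QC QT D in auto)
  show ?thesis
    unfolding damped_block_mat_def
    \<comment> \<open>The diagonal blocks enter as similarities, the other two as equations: the
      upper right identity block through \<open>inv\<close>, the lower left block through
      \<open>conj\<close>.\<close>
    by (rule similar_mat_wit_four_block[OF wit0 wit _ conj]) (use QC D in \<open>auto simp: inv\<close>)
qed

theorem theorem3p5:
  fixes n k :: nat
    and \<alpha> \<beta> \<gamma> \<delta> t :: real
    and S Q :: "real mat"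
    and lam :: "nat \<Rightarrow> real"
  assumes "n \<ge> 1"
    and "\<alpha> > 0" and "\<beta> \<ge> 0" and "\<gamma> \<ge> 0" and "\<delta> \<ge> 0"
    and "S \<in> carrier_mat n n"
    and "orthogonal_matrix_of_dim n Q"
    and "S = Q * mat_diag n lam * Q\<^sup>T"
    and "t > 0" and "k \<ge> 1"
  shows "phi_mat k (t \<cdot>\<^sub>m damped_block_mat n \<alpha> \<beta> \<gamma> \<delta> S) =
    four_block_mat Q (0\<^sub>m n n) (0\<^sub>m n n) Q
    * shuffle_perm_mat n
    * diag_block_mat (map (\<lambda>i. phi_mat k (t \<cdot>\<^sub>m damped_scalar_mat \<alpha> \<beta> \<gamma> \<delta> (lam i))) [0..<n])
    * (shuffle_perm_mat n)\<^sup>T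
    * four_block_mat Q\<^sup>T (0\<^sub>m n n) (0\<^sub>m n n) Q\<^sup>T"
proof -
  let ?G = "\<lambda>i. damped_scalar_mat \<alpha> \<beta> \<gamma> \<delta> (lam i)"
  let ?U = "four_block_mat Q (0\<^sub>m n n) (0\<^sub>m n n) Q"
  let ?V = "four_block_mat Q\<^sup>T (0\<^sub>m n n) (0\<^sub>m n n) Q\<^sup>T"
  let ?P = "shuffle_perm_mat n"
  let ?D = "diag_block_mat (map (\<lambda>i. phi_mat k (t \<cdot>\<^sub>m ?G i)) [0..<n])"
  have "similar_mat_wit (damped_block_mat n \<alpha> \<beta> \<gamma> \<delta> S) (diag_block_mat (map ?G [0..<n]))
      (?U * ?P) (?P\<^sup>T * ?V)"
    unfolding assms(8)
    by (rule similar_mat_wit_trans[OF damped_block_mat_similar damped_block_mat_diag_similar])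
      (use assms(7) in auto)
  \<comment> \<open>Scaling by \<open>t\<close> keeps the witnesses of a similarity.\<close>
  from phi_mat_similar[OF similar_mat_wit_smult[OF this, of t], of k]
  have "phi_mat k (t \<cdot>\<^sub>m damped_block_mat n \<alpha> \<beta> \<gamma> \<delta> S) =
      (?U * ?P) * phi_mat k (t \<cdot>\<^sub>m diag_block_mat (map ?G [0..<n])) * (?P\<^sup>T * ?V)" .
  also have "phi_mat k (t \<cdot>\<^sub>m diag_block_mat (map ?G [0..<n])) = ?D"
    unfolding smult_diag_block_mat
    by (subst phi_mat_diag_block) (auto simp: o_def carrier_matD[OF damped_scalar_mat_carrier])
  \<comment> \<open>Only the bracketing changes: the similarity groups
    \<open>?P\<^sup>T * ?V\<close>, while the claim associates to the left.\<close>
  also have "(?U * ?P) * ?D * (?P\<^sup>T * ?V) = ?U * ?P * ?D * ?P\<^sup>T * ?V"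
  proof (rule assoc_mult_mat[symmetric])
    have QC: "Q \<in> carrier_mat n n" using assms(7) by (simp add: orthogonal_matrix_of_dim_def)
    then have QT: "Q\<^sup>T \<in> carrier_mat n n" by simp
    have U: "?U \<in> carrier_mat (2 * n) (2 * n)"
      unfolding mult_2 by (rule four_block_carrier_mat[OF QC QC])
    have "?D \<in> carrier_mat (2 * n) (2 * n)"
      by (intro carrier_matI) (simp_all add: dim_diag_block_mat o_def sum_list_triv phi_mat_def
          carrier_matD[OF damped_scalar_mat_carrier])
    with U show "?U * ?P * ?D \<in> carrier_mat (2 * n) (2 * n)"
      by (intro mult_carrier_mat[of _ _ "2 * n"]) simp_all
    show "?P\<^sup>T \<in> carrier_mat (2 * n) (2 * n)" by simp
    show "?V \<in> carrier_mat (2 * n) (2 * n)"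
      unfolding mult_2 by (rule four_block_carrier_mat[OF QT QT])
  qed
  finally show ?thesis .
qed

end
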